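(* For any $n\times n$ complex invertible matrix $G$, there exist an $n\times n$ unitary matrix $U$, an $n\times n$ complex orthogonal matrix $O$, and a unique (up to permutation of the diagonal) $n\times n$ positive diagonal matrix $\Sigma$ such that $$G=U\Sigma O.$$
   Context: A complex orthogonal matrix is $O\in\mathbb{C}^{n\times n}$ with $O^TO=I_n$, where $^T$ is the ordinary (non-conjugate) transpose. A positive diagonal matrix is a real diagonal matrix with positive diagonal entries. *)

theory Defs
  imports "Jordan_Normal_Form.Schur_Decomposition"
begin

definition unitary_mat :: "nat \<Rightarrow> complex mat \<Rightarrow> bool" where
  "unitary_mat n U \<longleftrightarrow> U \<in> carrier_mat n n \<and> mat_adjoint U * U = 1\<^sub>m n"

text \<open>The transpose is not conjugated. The library predicate \<open>orthogonal_mat\<close> is weaker: it only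
  asks that the product of the transpose with the matrix is diagonal with nonzero diagonal entries.\<close>

definition complex_orthogonal_mat :: "nat \<Rightarrow> complex mat \<Rightarrow> bool" where
  "complex_orthogonal_mat n Q \<longleftrightarrow> Q \<in> carrier_mat n n \<and> transpose_mat Q * Q = 1\<^sub>m n"

definition positive_diagonal_mat :: "nat \<Rightarrow> real mat \<Rightarrow> bool" where
  "positive_diagonal_mat n S \<longleftrightarrow>
     S \<in> carrier_mat n n \<and> diagonal_mat S \<and> (\<forall>i<n. S $$ (i, i) > 0)"

definition same_diagonal_up_to_permutation :: "nat \<Rightarrow> real mat \<Rightarrow> real mat \<Rightarrow> bool" where
  "same_diagonal_up_to_permutation n S T \<longleftrightarrow>
     (\<exists>p. p permutes {..<n} \<and> (\<forall>i<n. T $$ (i, i) = S $$ (p i, p i)))"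

end

theory Submission
  imports Defs "Jordan_Normal_Form.Spectral_Radius"
begin

text \<open>Write \<open>*\<close> for the conjugate transpose and \<open>T\<close> for the transpose, and let \<open>H = G* G\<close>. A
  decomposition \<open>G = U S Q\<close> gives \<open>H = Q* S\<^sup>2 Q\<close>, and since \<open>Q\<^sup>T = Q\<^sup>-\<^sup>1\<close> the conjugate of \<open>H\<close> times
  \<open>H\<close> equals \<open>Q\<^sup>-\<^sup>1 S\<^sup>4 Q\<close>; its characteristic polynomial determines the diagonal of \<open>S\<close> up to order.

  Conversely it suffices to find a complex orthogonal \<open>P\<close> for which \<open>P* H P\<close> is a positive diagonal
  matrix: with \<open>S\<close> its square root, take \<open>U = G P S\<^sup>-\<^sup>1\<close> and \<open>Q = P\<^sup>T\<close>. Such a \<open>P\<close> is built by induction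
  on the dimension. There is a vector \<open>w\<close> such that \<open>H w\<close> is a positive multiple of the conjugate of
  \<open>w\<close>. Then \<open>w\<^sup>T w\<close> is positive, so \<open>w\<close> can be scaled to be the first column of a complex
  orthogonal matrix, and congruence with that matrix splits off a 1 by 1 block.\<close>

section \<open>Conjugate transposes and positive definite hermitian forms\<close>

interpretation cnj: comm_ring_hom cnj
  by unfold_locales auto

text \<open>Spelled with \<open>map_mat cnj\<close> so that the ring homomorphism lemmas of the
  interpretation above apply; \<open>mat_adjoint\<close> occurs only through
  \<open>unitary_mat\<close> and is rewritten to this form.\<close>

abbreviation cadj :: "complex mat \<Rightarrow> complex mat" where
  "cadj A \<equiv> transpose_mat (map_mat cnj A)"

lemma mat_adjoint_eq_transpose_cnj:
  "A \<in> carrier_mat n n \<Longrightarrow> mat_adjoint A = cadj A"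
  by (intro eq_matI) (auto simp: mat_adjoint_def mat_of_rows_def)

lemma cadj_mult:
  assumes "A \<in> carrier_mat nr n" "B \<in> carrier_mat n nc"
  shows "cadj (A * B) = cadj B * cadj A"
  using assms by (simp add: cnj.mat_hom_mult[OF assms] transpose_mult[of _ nr n _ nc])

lemma cadj_cadj [simp]: "cadj (cadj A) = A"
  by (intro eq_matI) auto

lemma conjugate_mult_mat_vec:
  assumes "A \<in> carrier_mat nr n" "v \<in> carrier_vec n"
  shows "conjugate (A *\<^sub>v v) = map_mat cnj A *\<^sub>v conjugate v"
proof -
  have c: "conjugate x = map_vec cnj x" for x :: "complex vec"
    by (intro eq_vecI) auto
  show ?thesis unfolding c by (rule cnj.mult_mat_vec_hom[OF assms])
qed

lemma complex_pos_iff: "0 < (z :: complex) \<longleftrightarrow> 0 < Re z \<and> Im z = 0"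
  by (auto simp: less_complex_def)

text \<open>The strict order on complex numbers compares real parts and requires equal imaginary
  parts, so positivity here includes that the value of the form is real.\<close>

definition hermitian_posdef :: "nat \<Rightarrow> complex mat \<Rightarrow> bool" where
  "hermitian_posdef n H \<longleftrightarrow> H \<in> carrier_mat n n \<and> cadj H = H \<and>
     (\<forall>v \<in> carrier_vec n. v \<noteq> 0\<^sub>v n \<longrightarrow> 0 < conjugate v \<bullet> (H *\<^sub>v v))"

text \<open>Adjointness for the hermitian form, obtained from the transposition rule for the
  bilinear scalar product together with its symmetry.\<close>

lemma sprod_cadj:
  fixes v w :: "complex vec"
  assumes "P \<in> carrier_mat nr nc" "v \<in> carrier_vec nc" "w \<in> carrier_vec nr"
  shows "conjugate v \<bullet> (cadj P *\<^sub>v w) = conjugate (P *\<^sub>v v) \<bullet> w"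
proof -
  have "conjugate v \<bullet> (cadj P *\<^sub>v w) = (cadj P *\<^sub>v w) \<bullet> conjugate v"
    by (rule comm_scalar_prod[of _ nc]) (use assms in auto)
  also have "\<dots> = w \<bullet> (map_mat cnj P *\<^sub>v conjugate v)"
    by (rule transpose_vec_mult_scalar[of _ nr nc]) (use assms in auto)
  also have "\<dots> = w \<bullet> conjugate (P *\<^sub>v v)"
    using assms by (simp add: conjugate_mult_mat_vec[of P nr nc])
  also have "\<dots> = conjugate (P *\<^sub>v v) \<bullet> w"
    by (rule comm_scalar_prod[of _ nr]) (use assms in auto)
  finally show ?thesis .
qed

text \<open>The new form at \<open>v\<close> has the value of the old form at
  \<open>P *\<^sub>v v\<close>, and the left inverse \<open>R\<close> makes \<open>P\<close>
  injective, so nonzero vectors stay nonzero.\<close>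

lemma hermitian_posdef_congruence:
  assumes H: "hermitian_posdef n H" and P: "P \<in> carrier_mat n n"
    and R: "R \<in> carrier_mat n n" "R * P = 1\<^sub>m n"
  shows "hermitian_posdef n (cadj P * H * P)"
  unfolding hermitian_posdef_def
proof (intro conjI ballI impI)
  have Hc: "H \<in> carrier_mat n n" and Hh: "cadj H = H"
    using H by (auto simp: hermitian_posdef_def)
  have P': "cadj P \<in> carrier_mat n n" using P by auto
  show "cadj P * H * P \<in> carrier_mat n n" using P P' Hc by auto
  show "cadj (cadj P * H * P) = cadj P * H * P"
    using P P' Hc Hh by (simp add: cadj_mult[of _ n n _ n] assoc_mult_mat[of _ n n _ n _ n])
  fix v :: "complex vec" assume v: "v \<in> carrier_vec n" "v \<noteq> 0\<^sub>v n"
  have Pv: "P *\<^sub>v v \<in> carrier_vec n" using P v by auto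
  have "P *\<^sub>v v \<noteq> 0\<^sub>v n"
  proof
    assume "P *\<^sub>v v = 0\<^sub>v n"
    then have "R *\<^sub>v (P *\<^sub>v v) = 0\<^sub>v n"
      using R(1) by (intro eq_vecI) auto
    moreover have "R *\<^sub>v (P *\<^sub>v v) = v"
      using assoc_mult_mat_vec[OF R(1) P v(1)] R(2) v(1) by simp
    ultimately show False using v(2) by simp
  qed
  then have "0 < conjugate (P *\<^sub>v v) \<bullet> (H *\<^sub>v (P *\<^sub>v v))"
    using H Pv unfolding hermitian_posdef_def by blast
  also have "\<dots> = conjugate v \<bullet> (cadj P *\<^sub>v (H *\<^sub>v (P *\<^sub>v v)))"
    using P v(1) Hc Pv by (intro sprod_cadj[symmetric]) auto
  also have "cadj P *\<^sub>v (H *\<^sub>v (P *\<^sub>v v)) = (cadj P * H * P) *\<^sub>v v"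
    using P P' Hc v by (simp add: assoc_mult_mat_vec[of _ n n _ n])
  finally show "0 < conjugate v \<bullet> ((cadj P * H * P) *\<^sub>v v)" .
qed

text \<open>The Gram matrix is the congruence of the identity by \<open>G\<close>.\<close>

lemma hermitian_posdef_gram:
  assumes G: "G \<in> carrier_mat n n" and R: "R \<in> carrier_mat n n" "R * G = 1\<^sub>m n"
  shows "hermitian_posdef n (cadj G * G)"
proof -
  have "hermitian_posdef n (1\<^sub>m n)"
    unfolding hermitian_posdef_def
  proof (intro conjI ballI impI)
    show "cadj (1\<^sub>m n) = 1\<^sub>m n" by (simp add: cnj.mat_hom_one)
    fix v :: "complex vec" assume v: "v \<in> carrier_vec n" "v \<noteq> 0\<^sub>v n"
    then have "0 < v \<bullet>c v" by simp
    then show "0 < conjugate v \<bullet> (1\<^sub>m n *\<^sub>v v)"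
      using v conjugate_vec_sprod_comm[of v n v] by simp
  qed simp
  from hermitian_posdef_congruence[OF this G R] show ?thesis
    using G by simp
qed

section \<open>Vectors mapped to positive multiples of their conjugates\<close>

text \<open>An eigenvector \<open>v\<close> of the conjugate of \<open>H\<close> times \<open>H\<close>, for an eigenvalue \<open>l\<^sup>2\<close>, is an eigenvector of
  the square of the antilinear map \<open>B x = conjugate (H x)\<close>. Hence \<open>w = B v + l v\<close> satisfies
  \<open>B w = l w\<close>; if \<open>w\<close> vanishes, then \<open>B v = - l v\<close> and \<open>\<i> v\<close> is the required vector.\<close>

lemma positive_antilinear_eigenvector:
  assumes H: "hermitian_posdef n H" and n: "n > 0"
  obtains w l where "w \<in> carrier_vec n" "w \<noteq> 0\<^sub>v n" "l > 0"
    "H *\<^sub>v w = complex_of_real l \<cdot>\<^sub>v conjugate w"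
proof -
  have Hc: "H \<in> carrier_mat n n"
    and pos: "\<And>v. v \<in> carrier_vec n \<Longrightarrow> v \<noteq> 0\<^sub>v n \<Longrightarrow> 0 < conjugate v \<bullet> (H *\<^sub>v v)"
    using H by (auto simp: hermitian_posdef_def)
  define K where "K = map_mat cnj H * H"
  have K: "K \<in> carrier_mat n n" using Hc by (auto simp: K_def)
  obtain k v where "eigenvector K v k"
    using spectrum_non_empty[OF K n] by (auto simp: spectrum_def eigenvalue_def)
  then have v: "v \<in> carrier_vec n" "v \<noteq> 0\<^sub>v n" and Kv: "K *\<^sub>v v = k \<cdot>\<^sub>v v"
    using K by (auto simp: eigenvector_def)
  define u where "u = H *\<^sub>v v"
  have u: "u \<in> carrier_vec n" using Hc v by (auto simp: u_def)
  have h: "0 < conjugate v \<bullet> u" using pos[OF v] by (simp add: u_def)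
  have "u \<noteq> 0\<^sub>v n" using h v by auto
  have "map_mat cnj H *\<^sub>v u = k \<cdot>\<^sub>v v"
    using Kv Hc v by (simp add: K_def u_def)
  then have "conjugate (map_mat cnj H *\<^sub>v u) = conjugate (k \<cdot>\<^sub>v v)" by simp
  moreover have "map_mat cnj (map_mat cnj H) = H" by (intro eq_matI) auto
  ultimately have Hu: "H *\<^sub>v conjugate u = cnj k \<cdot>\<^sub>v conjugate v"
    using Hc u by (simp add: conjugate_mult_mat_vec[of _ n n] conjugate_smult_vec)
  \<comment> \<open>Positivity of the form at \<open>conjugate u\<close> makes \<open>cnj k\<close>
    times a positive number positive, which forces \<open>k\<close> to be a positive real.\<close>
  have "0 < conjugate (conjugate u) \<bullet> (H *\<^sub>v conjugate u)"
    using u \<open>u \<noteq> 0\<^sub>v n\<close> by (intro pos) auto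
  also have "\<dots> = cnj k * (conjugate v \<bullet> u)"
    using u v by (simp add: Hu comm_scalar_prod[of u n])
  finally have "0 < Re k" "Im k = 0"
    using h by (auto simp: complex_pos_iff zero_less_mult_iff)
  then obtain m where m: "k = complex_of_real m" "m > 0"
    by (metis complex_is_Real_iff of_real_Re)
  define l where "l = sqrt m"
  have l: "l > 0" "m = l * l" using m by (auto simp: l_def)
  define w where "w = conjugate u + complex_of_real l \<cdot>\<^sub>v v"
  have w: "w \<in> carrier_vec n" using u v by (auto simp: w_def)
  have Hw: "H *\<^sub>v w = complex_of_real l \<cdot>\<^sub>v conjugate w"
  proof -
    have "H *\<^sub>v w = cnj k \<cdot>\<^sub>v conjugate v + complex_of_real l \<cdot>\<^sub>v u"
      using Hc u v by (simp add: w_def mult_add_distrib_mat_vec[of _ n n] mult_mat_vec[of _ n n] Hu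
          flip: u_def)
    also have "\<dots> = complex_of_real l \<cdot>\<^sub>v conjugate w"
      using u v by (intro eq_vecI) (auto simp: w_def m l algebra_simps)
    finally show ?thesis .
  qed
  show thesis
  proof (cases "w = 0\<^sub>v n")
    case False
    then show ?thesis using that w l Hw by blast
  next
    case True
    have u_eq: "u = - complex_of_real l \<cdot>\<^sub>v conjugate v"
    proof (intro eq_vecI)
      fix i assume i: "i < dim_vec (- complex_of_real l \<cdot>\<^sub>v conjugate v)"
      then have "w $ i = 0" using v by (simp add: True)
      then have "cnj (u $ i) = - l * v $ i"
        using i u v by (simp add: w_def add_eq_0_iff2)
      then have "cnj (cnj (u $ i)) = cnj (- l * v $ i)" by simp
      then show "u $ i = (- complex_of_real l \<cdot>\<^sub>v conjugate v) $ i"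
        using i v by simp
    qed (use u v in auto)
    \<comment> \<open>The map \<open>H\<close> pulls out the factor \<open>\<i>\<close>, conjugation
      pulls out its negative; the difference absorbs the minus sign of \<open>u_eq\<close>.\<close>
    have "H *\<^sub>v (\<i> \<cdot>\<^sub>v v) = \<i> \<cdot>\<^sub>v u"
      using Hc v by (simp add: mult_mat_vec[of _ n n] u_def)
    also have "\<dots> = complex_of_real l \<cdot>\<^sub>v conjugate (\<i> \<cdot>\<^sub>v v)"
      unfolding u_eq by (intro eq_vecI) auto
    finally have "H *\<^sub>v (\<i> \<cdot>\<^sub>v v) = complex_of_real l \<cdot>\<^sub>v conjugate (\<i> \<cdot>\<^sub>v v)" .
    moreover have "\<i> \<cdot>\<^sub>v v \<noteq> 0\<^sub>v n"
    proof
      assume "\<i> \<cdot>\<^sub>v v = 0\<^sub>v n"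
      then have "\<i> * v $ i = 0" if "i < n" for i
        using that v by (metis carrier_vecD index_smult_vec(1) index_zero_vec(1))
      then have "v = 0\<^sub>v n" using v by (intro eq_vecI) auto
      then show False using v by simp
    qed
    ultimately show ?thesis using that[of "\<i> \<cdot>\<^sub>v v" l] v l by simp
  qed
qed

text \<open>The form at \<open>w\<close> equals \<open>l\<close> times the conjugate of
  \<open>w \<bullet> w\<close>, so \<open>w \<bullet> w\<close> is a positive real and a real factor
  normalizes it. Real factors commute with conjugation and keep the eigenvector equation. Both signs
  of the factor are possible, and at least one of them avoids first entry 1, the case in which the
  reflection below is undefined.\<close>

lemma normalized_antilinear_eigenvector:
  assumes H: "hermitian_posdef n H" and n: "n > 0"
  obtains w l where "w \<in> carrier_vec n" "w \<bullet> w = 1" "w $ 0 \<noteq> 1" "l > 0"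
    "H *\<^sub>v w = complex_of_real l \<cdot>\<^sub>v conjugate w"
proof -
  have Hc: "H \<in> carrier_mat n n" using H by (auto simp: hermitian_posdef_def)
  obtain w l where w: "w \<in> carrier_vec n" "w \<noteq> 0\<^sub>v n" and l: "l > 0"
    and Hw: "H *\<^sub>v w = complex_of_real l \<cdot>\<^sub>v conjugate w"
    using positive_antilinear_eigenvector[OF H n] .
  have "0 < conjugate w \<bullet> (H *\<^sub>v w)"
    using H w by (auto simp: hermitian_posdef_def)
  also have "\<dots> = complex_of_real l * cnj (w \<bullet> w)"
    using w conjugate_sprod_vec[OF w(1) w(1)] by (simp add: Hw)
  finally have "0 < Re (w \<bullet> w)" "Im (w \<bullet> w) = 0"
    using l by (auto simp: complex_pos_iff zero_less_mult_iff)
  then obtain r where r: "w \<bullet> w = complex_of_real r" "r > 0"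
    by (metis complex_is_Real_iff of_real_Re)
  have scaled: "complex_of_real c \<cdot>\<^sub>v w \<in> carrier_vec n"
    "(complex_of_real c \<cdot>\<^sub>v w) \<bullet> (complex_of_real c \<cdot>\<^sub>v w) = 1"
    "H *\<^sub>v (complex_of_real c \<cdot>\<^sub>v w) = complex_of_real l \<cdot>\<^sub>v conjugate (complex_of_real c \<cdot>\<^sub>v w)"
    if "c * c * r = 1" for c
  proof -
    show "complex_of_real c \<cdot>\<^sub>v w \<in> carrier_vec n" using w by simp
    have "(complex_of_real c \<cdot>\<^sub>v w) \<bullet> (complex_of_real c \<cdot>\<^sub>v w) = complex_of_real (c * c * r)"
      using w by (simp add: r)
    then show "(complex_of_real c \<cdot>\<^sub>v w) \<bullet> (complex_of_real c \<cdot>\<^sub>v w) = 1" using that by simp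
    show "H *\<^sub>v (complex_of_real c \<cdot>\<^sub>v w)
        = complex_of_real l \<cdot>\<^sub>v conjugate (complex_of_real c \<cdot>\<^sub>v w)"
      using Hc w by (auto simp: mult_mat_vec[of _ n n] Hw conjugate_smult_vec)
  qed
  define c where "c = 1 / sqrt r"
  have c: "c * c * r = 1" "(-c) * (-c) * r = 1"
    using r by (auto simp: c_def field_simps)
  show thesis
  proof (cases "complex_of_real c * w $ 0 = 1")
    case False
    then show ?thesis using that[OF scaled(1,2)[OF c(1)] _ l scaled(3)[OF c(1)]] w n by simp
  next
    case True
    then have "complex_of_real (- c) * w $ 0 \<noteq> 1" by (simp add: minus_equation_iff)
    then show ?thesis using that[OF scaled(1,2)[OF c(2)] _ l scaled(3)[OF c(2)]] w n by simp
  qed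
qed

section \<open>Complex orthogonal matrices\<close>

text \<open>The complex Householder reflection exchanging \<open>w\<close> and the first unit vector exists because
  the difference of these two vectors is not isotropic when the first entry of \<open>w\<close> is not 1.\<close>

lemma complex_orthogonal_mat_with_first_col:
  assumes w: "w \<in> carrier_vec n" "w \<bullet> w = 1" "w $ 0 \<noteq> 1" and n: "n > 0"
  obtains Q where "complex_orthogonal_mat n Q" "col Q 0 = w"
proof -
  define u where "u i = w $ i - (if i = 0 then 1 else 0)" for i
  \<comment> \<open>The usual factor 2 divided by the bilinear square of \<open>u\<close>: since
    \<open>w \<bullet> w = 1\<close>, that square is \<open>2 * (1 - w $ 0)\<close>.\<close>
  define c where "c = 1 / (1 - w $ 0)"
  have w2: "(\<Sum>i<n. w $ i * w $ i) = 1"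
    using w by (simp add: scalar_prod_def atLeast0LessThan)
  have "(\<Sum>i<n. u i * u i)
      = (\<Sum>i<n. w $ i * w $ i - (if i = 0 then 2 * w $ i - 1 else 0))"
    by (intro sum.cong) (auto simp: u_def algebra_simps)
  also have "\<dots> = 2 * (1 - w $ 0)"
    using n by (simp add: sum_subtractf w2)
  finally have uu: "c * (\<Sum>i<n. u i * u i) = 2"
    using w(3) by (simp add: c_def divide_simps)
  define q where "q i j = (if i = j then 1 else 0) - c * u i * u j" for i j
  define Q where "Q = mat n n (\<lambda>(i, j). q i j)"
  have "transpose_mat Q * Q = 1\<^sub>m n"
  proof (intro eq_matI)
    fix i j assume "i < dim_row (1\<^sub>m n)" "j < dim_col (1\<^sub>m n)"
    then have ij: "i < n" "j < n" by auto
    have "(transpose_mat Q * Q) $$ (i, j) = (\<Sum>k<n. q k i * q k j)"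
      using ij by (simp add: Q_def scalar_prod_def atLeast0LessThan)
    \<comment> \<open>The product is expanded so that the two Kronecker deltas select single terms;
      the remaining quadratic part is evaluated by \<open>uu\<close> and cancels both copies of
      \<open>c * u i * u j\<close>.\<close>
    also have "\<dots> = (\<Sum>k<n. (if k = i then (if i = j then 1 else 0) - c * u i * u j else 0)
        - (if k = j then c * u i * u j else 0) + c * u i * u j * (c * (u k * u k)))"
      by (intro sum.cong) (auto simp: q_def algebra_simps)
    also have "\<dots> = (if i = j then 1 else 0) - c * u i * u j - c * u i * u j
        + c * u i * u j * (c * (\<Sum>k<n. u k * u k))"
      using ij by (simp add: sum.distrib sum_subtractf sum_distrib_left)
    also have "\<dots> = 1\<^sub>m n $$ (i, j)" using ij by (simp add: uu)
    finally show "(transpose_mat Q * Q) $$ (i, j) = 1\<^sub>m n $$ (i, j)" .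
  qed (auto simp: Q_def)
  then have "complex_orthogonal_mat n Q"
    by (auto simp: complex_orthogonal_mat_def Q_def)
  moreover have "col Q 0 = w"
  proof (intro eq_vecI)
    fix i assume "i < dim_vec w"
    then have i: "i < n" using w by simp
    \<comment> \<open>Hence the first column is the first unit vector plus \<open>u\<close>, which
      is \<open>w\<close>.\<close>
    have "c * u 0 = -1" using w(3) by (simp add: c_def u_def field_simps)
    then have "q i 0 = (if i = 0 then 1 else 0) + u i"
      using mult.assoc[of "u i" c "u 0"] by (simp add: q_def mult.commute[of c])
    then show "col Q 0 $ i = w $ i" using i n by (simp add: Q_def u_def)
  qed (use w in \<open>auto simp: Q_def\<close>)
  ultimately show thesis using that by blast
qed


lemma complex_orthogonal_matD:
  assumes "complex_orthogonal_mat n Q"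
  shows "Q \<in> carrier_mat n n" "transpose_mat Q * Q = 1\<^sub>m n" "Q * transpose_mat Q = 1\<^sub>m n"
proof -
  show Q: "Q \<in> carrier_mat n n" and QQ: "transpose_mat Q * Q = 1\<^sub>m n"
    using assms by (auto simp: complex_orthogonal_mat_def)
  show "Q * transpose_mat Q = 1\<^sub>m n"
    by (rule mat_mult_left_right_inverse[OF _ Q QQ]) (use Q in auto)
qed

lemma complex_orthogonal_mat_mult:
  assumes "complex_orthogonal_mat n P" "complex_orthogonal_mat n Q"
  shows "complex_orthogonal_mat n (P * Q)"
proof -
  note P = complex_orthogonal_matD[OF assms(1)] and Q = complex_orthogonal_matD[OF assms(2)]
  have T: "transpose_mat P \<in> carrier_mat n n" "transpose_mat Q \<in> carrier_mat n n"
    using P(1) Q(1) by auto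
  have "transpose_mat (P * Q) * (P * Q) = transpose_mat Q * ((transpose_mat P * P) * Q)"
    using P(1) Q(1) T
    by (simp add: transpose_mult[of _ n n _ n] assoc_mult_mat[of _ n n _ n _ n])
  also have "\<dots> = 1\<^sub>m n" using P Q by simp
  finally show ?thesis using P Q by (simp add: complex_orthogonal_mat_def)
qed

lemma complex_orthogonal_mat_transpose:
  assumes "complex_orthogonal_mat n Q"
  shows "complex_orthogonal_mat n (transpose_mat Q)"
  using complex_orthogonal_matD[OF assms] by (simp add: complex_orthogonal_mat_def)

section \<open>Diagonalization by complex orthogonal congruence\<close>

text \<open>Hermitian symmetry carries the zeros of the first column over to the first row. The
  remaining block inherits positivity by evaluating the form of \<open>K\<close> at vectors padded
  with a leading zero.\<close>

lemma hermitian_posdef_split: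
  assumes H: "hermitian_posdef (Suc m) K"
    and Ke: "K *\<^sub>v unit_vec (Suc m) 0 = complex_of_real l \<cdot>\<^sub>v unit_vec (Suc m) 0"
  obtains K' where "hermitian_posdef m K'"
    "K = four_block_mat (mat 1 1 (\<lambda>_. complex_of_real l)) (0\<^sub>m 1 m) (0\<^sub>m m 1) K'"
proof -
  have Kc: "K \<in> carrier_mat (Suc m) (Suc m)" and Kh: "cadj K = K"
    using H by (auto simp: hermitian_posdef_def)
  have sym: "K $$ (i, j) = cnj (K $$ (j, i))" if "i < Suc m" "j < Suc m" for i j
  proof -
    have "cadj K $$ (i, j) = cnj (K $$ (j, i))" using that Kc by simp
    then show ?thesis by (simp add: Kh)
  qed
  have col: "K $$ (i, 0) = (if i = 0 then complex_of_real l else 0)" if "i < Suc m" for i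
  proof -
    have "K $$ (i, 0) = (K *\<^sub>v unit_vec (Suc m) 0) $ i"
      using that Kc by simp
    then show ?thesis using that by (simp add: Ke)
  qed
  define K' where "K' = mat m m (\<lambda>(i, j). K $$ (Suc i, Suc j))"
  have K'c: "K' \<in> carrier_mat m m" by (simp add: K'_def)
  have K_eq: "K = four_block_mat (mat 1 1 (\<lambda>_. complex_of_real l)) (0\<^sub>m 1 m) (0\<^sub>m m 1) K'"
    (is "K = ?B")
  proof (rule eq_matI)
    fix i j assume "i < dim_row ?B" "j < dim_col ?B"
    then have "i < Suc m" "j < Suc m" by (auto simp: K'_def)
    then show "K $$ (i, j) = ?B $$ (i, j)"
      using sym[of 0 j] by (cases i; cases j) (auto simp: K'_def col)
  qed (use Kc in \<open>auto simp: K'_def\<close>)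
  have "hermitian_posdef m K'"
    unfolding hermitian_posdef_def
  proof (intro conjI ballI impI K'c)
    show "cadj K' = K'"
      by (intro eq_matI) (auto simp: K'_def sym[symmetric])
    fix v :: "complex vec" assume v: "v \<in> carrier_vec m" "v \<noteq> 0\<^sub>v m"
    define x where "x = 0\<^sub>v 1 @\<^sub>v v"
    have x: "x \<in> carrier_vec (Suc m)"
      unfolding x_def carrier_vec_def using v(1) by simp
    have "x \<noteq> 0\<^sub>v (Suc m)"
    proof
      assume "x = 0\<^sub>v (Suc m)"
      then have "x $ Suc i = 0" if "i < m" for i using that by simp
      then have "v = 0\<^sub>v m"
        using v(1) by (intro eq_vecI) (auto simp: x_def)
      then show False using v(2) by simp
    qed
    then have "0 < conjugate x \<bullet> (K *\<^sub>v x)"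
      using H x by (auto simp: hermitian_posdef_def)
    also have "K *\<^sub>v x = 0\<^sub>v 1 @\<^sub>v (K' *\<^sub>v v)"
    proof -
      have "K *\<^sub>v x = (mat 1 1 (\<lambda>_. complex_of_real l) *\<^sub>v 0\<^sub>v 1 + 0\<^sub>m 1 m *\<^sub>v v)
          @\<^sub>v (0\<^sub>m m 1 *\<^sub>v 0\<^sub>v 1 + K' *\<^sub>v v)"
        unfolding x_def K_eq
        by (rule four_block_mat_mult_vec[OF _ _ _ K'c]) (use v in auto)
      also have "\<dots> = 0\<^sub>v 1 @\<^sub>v (K' *\<^sub>v v)"
        using v(1) K'c by (intro arg_cong2[where f = append_vec] eq_vecI) auto
      finally show ?thesis .
    qed
    also have "conjugate x = 0\<^sub>v 1 @\<^sub>v conjugate v"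
      by (intro eq_vecI) (auto simp: x_def)
    also have "(0\<^sub>v 1 @\<^sub>v conjugate v) \<bullet> (0\<^sub>v 1 @\<^sub>v (K' *\<^sub>v v)) = conjugate v \<bullet> (K' *\<^sub>v v)"
      using v(1) K'c by (subst scalar_prod_append[of _ 1 _ m]) auto
    finally show "0 < conjugate v \<bullet> (K' *\<^sub>v v)" .
  qed
  then show thesis using that K_eq by blast
qed

text \<open>In the induction step, \<open>Q\<close> has first column \<open>w\<close>, so the
  congruent matrix \<open>K\<close> maps the first unit vector to \<open>l\<close> times itself and
  splits. The induction hypothesis diagonalizes the smaller block by \<open>P'\<close>, and
  \<open>Q * B\<close> combines both matrices.\<close>

lemma hermitian_posdef_orthogonal_congruence_diagonal:
  assumes "hermitian_posdef n H"
  shows "\<exists>P S. complex_orthogonal_mat n P \<and> positive_diagonal_mat n S \<and>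
    cadj P * H * P = map_mat complex_of_real S"
  using assms
proof (induction n arbitrary: H)
  case 0
  then have "H \<in> carrier_mat 0 0" by (simp add: hermitian_posdef_def)
  then show ?case
    by (intro exI[of _ "1\<^sub>m 0"])
      (auto simp: complex_orthogonal_mat_def positive_diagonal_mat_def diagonal_mat_def
        intro!: exI[of _ "1\<^sub>m 0"])
next
  case (Suc m)
  let ?n = "Suc m"
  have Hc: "H \<in> carrier_mat ?n ?n" using Suc.prems by (simp add: hermitian_posdef_def)
  obtain w l where w: "w \<in> carrier_vec ?n" "w \<bullet> w = 1" "w $ 0 \<noteq> 1" and l: "l > 0"
    and Hw: "H *\<^sub>v w = complex_of_real l \<cdot>\<^sub>v conjugate w"
    using normalized_antilinear_eigenvector[OF Suc.prems] by auto
  obtain Q where Qo: "complex_orthogonal_mat ?n Q" and Q0: "col Q 0 = w"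
    using complex_orthogonal_mat_with_first_col[OF w] by auto
  note Q = complex_orthogonal_matD[OF Qo]
  define K where "K = cadj Q * H * Q"
  have Kp: "hermitian_posdef ?n K"
    unfolding K_def by (rule hermitian_posdef_congruence[OF Suc.prems Q(1) _ Q(2)]) (use Q in auto)
  let ?e = "unit_vec ?n 0 :: complex vec"
  have Qe: "Q *\<^sub>v ?e = w"
    using Q(1) Q0 by (intro eq_vecI) auto
  have "transpose_mat Q *\<^sub>v w = ?e"
  proof -
    have "transpose_mat Q *\<^sub>v w = (transpose_mat Q * Q) *\<^sub>v ?e"
      using Q(1) by (subst assoc_mult_mat_vec[of _ ?n ?n _ ?n]) (auto simp: Qe)
    then show ?thesis by (simp add: Q(2))
  qed
  \<comment> \<open>The unit vector is real, so conjugating the previous equation shows that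
    \<open>cadj Q\<close> sends the conjugate of \<open>w\<close> to it. This is why
    \<open>H\<close> must map \<open>w\<close> to a multiple of its conjugate rather than of
    \<open>w\<close> itself.\<close>
  then have Tw: "conjugate (transpose_mat Q *\<^sub>v w) = ?e"
    by (auto simp: unit_vec_def intro!: eq_vecI)
  have adjw: "cadj Q *\<^sub>v conjugate w = ?e"
    using Q(1) w(1) by (simp add: conjugate_mult_mat_vec[of _ ?n ?n] Tw[symmetric] map_mat_transpose)
  have "K *\<^sub>v ?e = cadj Q *\<^sub>v (H *\<^sub>v (Q *\<^sub>v ?e))"
    using Q(1) Hc by (simp add: K_def assoc_mult_mat_vec[of _ ?n ?n _ ?n])
  also have "\<dots> = complex_of_real l \<cdot>\<^sub>v ?e"
    using Q(1) w(1) by (simp add: Qe Hw mult_mat_vec[of _ ?n ?n] adjw)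
  finally obtain K' where K'p: "hermitian_posdef m K'"
    and K_eq: "K = four_block_mat (mat 1 1 (\<lambda>_. complex_of_real l)) (0\<^sub>m 1 m) (0\<^sub>m m 1) K'"
    using hermitian_posdef_split[OF Kp] by blast
  obtain P' S' where P'o: "complex_orthogonal_mat m P'" and S': "positive_diagonal_mat m S'"
    and P'K': "cadj P' * K' * P' = map_mat complex_of_real S'"
    using Suc.IH[OF K'p] by blast
  note P' = complex_orthogonal_matD[OF P'o]
  have K'c: "K' \<in> carrier_mat m m" using K'p by (simp add: hermitian_posdef_def)
  have S'c: "S' \<in> carrier_mat m m" using S' by (simp add: positive_diagonal_mat_def)
  \<comment> \<open>Bordering \<open>P'\<close> with a 1 keeps it complex orthogonal and leaves the
    split-off entry \<open>l\<close> unchanged.\<close>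
  define B where "B = four_block_mat (1\<^sub>m 1) (0\<^sub>m 1 m) (0\<^sub>m m 1) P'"
  define S where "S = four_block_mat (mat 1 1 (\<lambda>_. l)) (0\<^sub>m 1 m) (0\<^sub>m m 1) S'"
  have Bc: "B \<in> carrier_mat ?n ?n"
    using P'(1) four_block_carrier_mat[of "1\<^sub>m 1" 1 1 P' m m] by (simp add: B_def)
  have BT: "transpose_mat B = four_block_mat (1\<^sub>m 1) (0\<^sub>m 1 m) (0\<^sub>m m 1) (transpose_mat P')"
    unfolding B_def using P'(1) by (subst transpose_four_block_mat[of _ 1 1 _ m _ m]) auto
  have Badj: "cadj B = four_block_mat (1\<^sub>m 1) (0\<^sub>m 1 m) (0\<^sub>m m 1) (cadj P')"
    unfolding B_def using P'(1) by (intro eq_matI) auto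
  have "transpose_mat B * B = four_block_mat (1\<^sub>m 1) (0\<^sub>m 1 m) (0\<^sub>m m 1) (1\<^sub>m m)"
    unfolding BT unfolding B_def using P'
    by (subst mult_four_block_mat[of _ 1 1 _ m _ m _ _ 1 _ m]) auto
  then have Bo: "complex_orthogonal_mat ?n B"
    using Bc by (simp add: complex_orthogonal_mat_def)
  have "cadj B * K * B
      = four_block_mat (mat 1 1 (\<lambda>_. complex_of_real l)) (0\<^sub>m 1 m) (0\<^sub>m m 1) (cadj P' * K' * P')"
  proof -
    have "cadj B * K
        = four_block_mat (mat 1 1 (\<lambda>_. complex_of_real l)) (0\<^sub>m 1 m) (0\<^sub>m m 1) (cadj P' * K')"
      unfolding Badj K_eq using P'(1) K'c
      by (subst mult_four_block_mat[of _ 1 1 _ m _ m _ _ 1 _ m]) auto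
    then show ?thesis
      unfolding B_def using P'(1) K'c
      by (simp, subst mult_four_block_mat[of _ 1 1 _ m _ m _ _ 1 _ m]) auto
  qed
  also have "\<dots> = map_mat complex_of_real S"
    unfolding P'K' S_def using S'c
    by (subst map_four_block_mat[of _ 1 1 _ m _ m])
      (auto intro!: cong_four_block_mat eq_matI)
  finally have BKB: "cadj B * K * B = map_mat complex_of_real S" .
  have "positive_diagonal_mat ?n S"
    using S' l unfolding positive_diagonal_mat_def diagonal_mat_def S_def
    by (auto simp: less_Suc_eq_0_disj, blast)
  moreover have "cadj (Q * B) * H * (Q * B) = cadj B * K * B"
    using Q(1) Bc Hc by (simp add: K_def cadj_mult[of _ ?n ?n _ ?n] assoc_mult_mat[of _ ?n ?n _ ?n _ ?n])
  ultimately show ?case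
    using complex_orthogonal_mat_mult[OF Qo Bo] BKB by metis
qed

section \<open>Uniqueness of the diagonal\<close>

lemma diagonal_mat_mult:
  fixes A B :: "'a :: semiring_0 mat"
  assumes "A \<in> carrier_mat n n" "B \<in> carrier_mat n n" "diagonal_mat A" "diagonal_mat B"
  shows "A * B = mat n n (\<lambda>(i, j). if i = j then A $$ (i, i) * B $$ (i, i) else 0)"
proof (intro eq_matI)
  fix i j assume "i < dim_row (mat n n (\<lambda>(i, j). if i = j then A $$ (i, i) * B $$ (i, i) else 0))"
    "j < dim_col (mat n n (\<lambda>(i, j). if i = j then A $$ (i, i) * B $$ (i, i) else 0))"
  then have ij: "i < n" "j < n" by auto
  have "(A * B) $$ (i, j) = (\<Sum>k<n. A $$ (i, k) * B $$ (k, j))"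
    using assms ij by (simp add: scalar_prod_def atLeast0LessThan)
  also have "\<dots> = (\<Sum>k<n. if k = i then (if i = j then A $$ (i, i) * B $$ (i, i) else 0) else 0)"
    using assms ij by (intro sum.cong) (auto simp: diagonal_mat_def)
  finally show "(A * B) $$ (i, j)
      = mat n n (\<lambda>(i, j). if i = j then A $$ (i, i) * B $$ (i, i) else 0) $$ (i, j)"
    using ij by simp
qed (use assms in auto)

text \<open>Roots are taken as a multiset, since multiplicities are needed to obtain a permutation
  of the diagonal.\<close>

lemma proots_char_poly_upper_triangular:
  fixes A :: "'a :: idom mat"
  assumes "A \<in> carrier_mat n n" "upper_triangular A"
  shows "proots (char_poly A) = mset (diag_mat A)"
proof -
  have "proots (\<Prod>a\<leftarrow>xs. [:- a, 1:]) = mset xs" for xs :: "'a list"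
  proof (induction xs)
    case (Cons a xs)
    have "(\<Prod>a\<leftarrow>xs. [:- a, 1:]) \<noteq> 0"
      by (auto simp: prod_list_zero_iff)
    then show ?case
      using Cons proots_mult[of "[:- a, 1:]" "\<Prod>a\<leftarrow>xs. [:- a, 1:]"]
      by (simp del: mult_pCons_left)
  qed simp
  then show ?thesis using char_poly_upper_triangular[OF assms] by simp
qed

text \<open>The left side depends on \<open>G\<close> alone, so it can be compared between two
  decompositions. The matrix \<open>cadj G * G\<close> is only congruent to \<open>E\<close>, as
  \<open>cadj Q\<close> need not invert \<open>Q\<close>; multiplying by the conjugate matrix turns
  the congruence into a similarity.\<close>

lemma singular_value_quartics_eq_proots:
  assumes S: "positive_diagonal_mat n S" and U: "unitary_mat n U"
    and Q: "complex_orthogonal_mat n Q" and G: "G = U * map_mat complex_of_real S * Q"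
  shows "proots (char_poly (map_mat cnj (cadj G * G) * (cadj G * G)))
    = image_mset (\<lambda>i. complex_of_real (S $$ (i, i) ^ 4)) (mset_set {..<n})"
proof -
  define D where "D = map_mat complex_of_real S"
  have Sc: "S \<in> carrier_mat n n" and Sd: "diagonal_mat S"
    using S by (auto simp: positive_diagonal_mat_def)
  have D: "D \<in> carrier_mat n n" "diagonal_mat D"
    using Sc Sd by (auto simp: D_def diagonal_mat_def)
  have "cadj D = D"
    using Sc Sd by (intro eq_matI) (auto simp: D_def diagonal_mat_def, metis)
  have Uc: "U \<in> carrier_mat n n" and UU: "cadj U * U = 1\<^sub>m n"
    using U by (auto simp: unitary_mat_def mat_adjoint_eq_transpose_cnj)
  note Q = complex_orthogonal_matD[OF Q]
  define E where "E = D * D"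
  have E: "E = mat n n (\<lambda>(i, j). if i = j then complex_of_real (S $$ (i, i) ^ 2) else 0)"
    unfolding E_def diagonal_mat_mult[OF D(1) D(1) D(2) D(2)]
    using Sc by (intro eq_matI) (auto simp: D_def power2_eq_square)
  have Ec: "E \<in> carrier_mat n n" and Ed: "diagonal_mat E"
    by (auto simp: E diagonal_mat_def)
  have Ecnj: "map_mat cnj E = E"
    by (intro eq_matI) (auto simp: E)
  define F where "F = E * E"
  have F: "F = mat n n (\<lambda>(i, j). if i = j then complex_of_real (S $$ (i, i) ^ 4) else 0)"
    unfolding F_def diagonal_mat_mult[OF Ec Ec Ed Ed]
    by (intro eq_matI) (auto simp: E simp flip: power_add)
  have Fc: "F \<in> carrier_mat n n" by (simp add: F)
  have T: "cadj U \<in> carrier_mat n n" "cadj Q \<in> carrier_mat n n" "transpose_mat Q \<in> carrier_mat n n"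
    "map_mat cnj Q \<in> carrier_mat n n"
    using Uc Q(1) by auto
  have G': "G = U * D * Q" by (simp add: G D_def)
  have "cadj G = cadj Q * D * cadj U"
    unfolding G' using Uc D Q(1) T \<open>cadj D = D\<close>
    by (simp add: cadj_mult[of _ n n _ n] assoc_mult_mat[of _ n n _ n _ n])
  then have "cadj G * G = cadj Q * (D * ((cadj U * U) * (D * Q)))"
    using Uc D Q(1) T by (simp add: G' assoc_mult_mat[of _ n n _ n _ n])
  also have "\<dots> = cadj Q * E * Q"
    using D Q(1) T by (simp add: UU E_def assoc_mult_mat[of _ n n _ n _ n])
  finally have H: "cadj G * G = cadj Q * E * Q" .
  have cc: "map_mat cnj (cadj Q) = transpose_mat Q"
    by (intro eq_matI) auto
  have cnjH: "map_mat cnj (cadj G * G) = transpose_mat Q * E * map_mat cnj Q"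
    unfolding H using Q(1) Ec T
    by (simp add: cnj.mat_hom_mult[of _ n n _ n] cc Ecnj)
  \<comment> \<open>The inner factors cancel because their product is the conjugate of
    \<open>Q * transpose_mat Q\<close>.\<close>
  have "map_mat cnj Q * cadj Q = map_mat cnj (Q * transpose_mat Q)"
    using Q(1) T by (simp add: cnj.mat_hom_mult[of _ n n _ n] map_mat_transpose)
  then have one: "map_mat cnj Q * cadj Q = 1\<^sub>m n"
    by (simp add: Q(3) cnj.mat_hom_one)
  have "map_mat cnj (cadj G * G) * (cadj G * G)
      = transpose_mat Q * (E * ((map_mat cnj Q * cadj Q) * (E * Q)))"
    unfolding cnjH unfolding H
    using Q(1) Ec T by (simp add: assoc_mult_mat[of _ n n _ n _ n])
  also have "\<dots> = transpose_mat Q * F * Q"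
    using Q(1) Ec T by (simp add: one F_def assoc_mult_mat[of _ n n _ n _ n])
  finally have K: "map_mat cnj (cadj G * G) * (cadj G * G) = transpose_mat Q * F * Q" .
  have "similar_mat (transpose_mat Q * F * Q) F"
    unfolding similar_mat_def
    by (intro exI, rule similar_mat_witI[OF Q(2,3) refl _ Fc T(3) Q(1)]) (use Fc Q T in auto)
  then have "proots (char_poly (map_mat cnj (cadj G * G) * (cadj G * G))) = proots (char_poly F)"
    by (simp add: K char_poly_similar)
  also have "\<dots> = mset (diag_mat F)"
    by (rule proots_char_poly_upper_triangular[OF Fc]) (auto simp: F)
  also have "diag_mat F = map (\<lambda>i. complex_of_real (S $$ (i, i) ^ 4)) [0..<n]"
    by (auto simp: diag_mat_def F)
  also have "mset \<dots> = image_mset (\<lambda>i. complex_of_real (S $$ (i, i) ^ 4)) (mset_set {..<n})"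
    by (simp add: atLeast0LessThan)
  finally show ?thesis .
qed

text \<open>Equal image multisets over one finite index set differ by a permutation of the indices,
  and fourth powers are injective on nonnegative reals.\<close>

lemma same_diagonal_up_to_permutation_if_decompositions:
  assumes S: "positive_diagonal_mat n S" "unitary_mat n U" "complex_orthogonal_mat n Q"
      "G = U * map_mat complex_of_real S * Q"
    and T: "positive_diagonal_mat n T" "unitary_mat n V" "complex_orthogonal_mat n R"
      "G = V * map_mat complex_of_real T * R"
  shows "same_diagonal_up_to_permutation n S T"
proof -
  have "image_mset (\<lambda>i. complex_of_real (T $$ (i, i) ^ 4)) (mset_set {..<n})
      = image_mset (\<lambda>i. complex_of_real (S $$ (i, i) ^ 4)) (mset_set {..<n})"
    using singular_value_quartics_eq_proots[OF S] singular_value_quartics_eq_proots[OF T] by simp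
  then obtain p where p: "p permutes {..<n}"
    and eq: "\<forall>i\<in>{..<n}. complex_of_real (T $$ (i, i) ^ 4) = complex_of_real (S $$ (p i, p i) ^ 4)"
    using image_mset_eq_implies_permutes[of "{..<n}"] by blast
  have "T $$ (i, i) = S $$ (p i, p i)" if "i < n" for i
  proof (rule power_eq_imp_eq_base[of _ 4])
    have "p i < n" using permutes_in_image[OF p, of i] that by simp
    then show "0 \<le> T $$ (i, i)" "0 \<le> S $$ (p i, p i)"
      using S(1) T(1) that by (auto simp: positive_diagonal_mat_def intro: less_imp_le)
    show "T $$ (i, i) ^ 4 = S $$ (p i, p i) ^ 4"
      using eq that of_real_eq_iff by blast
  qed simp
  then show ?thesis
    using p unfolding same_diagonal_up_to_permutation_def by blast
qed

section \<open>Existence of the decomposition\<close>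

lemma unitary_diagonal_orthogonal_decomposition:
  assumes G: "G \<in> carrier_mat n n" and R: "R \<in> carrier_mat n n" "R * G = 1\<^sub>m n"
  obtains S U Q where "positive_diagonal_mat n S" "unitary_mat n U" "complex_orthogonal_mat n Q"
    "G = U * map_mat complex_of_real S * Q"
proof -
  obtain P S2 where Po: "complex_orthogonal_mat n P" and S2: "positive_diagonal_mat n S2"
    and PHP: "cadj P * (cadj G * G) * P = map_mat complex_of_real S2"
    using hermitian_posdef_orthogonal_congruence_diagonal[OF hermitian_posdef_gram[OF G R]] by blast
  note P = complex_orthogonal_matD[OF Po]
  have S2c: "S2 \<in> carrier_mat n n" and S2d: "diagonal_mat S2"
    and S2p: "\<And>i. i < n \<Longrightarrow> 0 < S2 $$ (i, i)"
    using S2 by (auto simp: positive_diagonal_mat_def)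
  define S where "S = map_mat sqrt S2"
  define D where "D = map_mat complex_of_real S"
  \<comment> \<open>The inverse of \<open>D\<close>. It is real and diagonal, hence its own adjoint,
    so in \<open>cadj U * U\<close> the outer factors \<open>J\<close> cancel \<open>D * D\<close>
    from both sides.\<close>
  define J where "J = map_mat (\<lambda>x. complex_of_real (inverse (sqrt x))) S2"
  have D: "D \<in> carrier_mat n n" "diagonal_mat D" and J: "J \<in> carrier_mat n n" "diagonal_mat J"
    using S2c S2d by (auto simp: D_def J_def S_def diagonal_mat_def)
  have "map_mat complex_of_real S2 = D * D"
    unfolding diagonal_mat_mult[OF D(1) D(1) D(2) D(2)]
    using S2c S2d S2p
    by (intro eq_matI) (auto simp: D_def S_def diagonal_mat_def less_imp_le simp flip: of_real_mult)
  with PHP have PHP: "cadj P * (cadj G * G) * P = D * D" by simp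
  have JD: "J * D = 1\<^sub>m n" and DJ: "D * J = 1\<^sub>m n"
    unfolding diagonal_mat_mult[OF J(1) D(1) J(2) D(2)] diagonal_mat_mult[OF D(1) J(1) D(2) J(2)]
    using S2c less_imp_neq[OF S2p]
    by (auto intro!: eq_matI simp: D_def J_def S_def simp flip: of_real_mult)
  have Jadj: "cadj J = J"
    using S2c S2d by (intro eq_matI) (auto simp: J_def diagonal_mat_def, metis)
  define U where "U = G * P * J"
  have Uc: "U \<in> carrier_mat n n" using G P J by (auto simp: U_def)
  have T: "cadj P \<in> carrier_mat n n" "cadj G \<in> carrier_mat n n" "transpose_mat P \<in> carrier_mat n n"
    using G P(1) by auto
  have "cadj U * U = J * (cadj P * (cadj G * G) * P) * J"
    unfolding U_def using G P(1) J T
    by (simp add: cadj_mult[of _ n n _ n] Jadj assoc_mult_mat[of _ n n _ n _ n])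
  also have "\<dots> = (J * D) * (D * J)"
    unfolding PHP using D J by (simp add: assoc_mult_mat[of _ n n _ n _ n])
  finally have "unitary_mat n U"
    using Uc by (simp add: JD DJ unitary_mat_def mat_adjoint_eq_transpose_cnj)
  moreover have "G = U * D * transpose_mat P"
  proof -
    have "U * D * transpose_mat P = G * (P * ((J * D) * transpose_mat P))"
      unfolding U_def using G P(1) J D T by (simp add: assoc_mult_mat[of _ n n _ n _ n])
    then show ?thesis using G P T by (simp add: JD)
  qed
  moreover have "positive_diagonal_mat n S"
    using S2c S2d S2p by (auto simp: positive_diagonal_mat_def S_def diagonal_mat_def)
  ultimately show thesis
    using that complex_orthogonal_mat_transpose[OF Po] by (simp add: D_def)
qed

theorem theorem5p14:
  fixes n :: nat and G :: "complex mat"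
  assumes "G \<in> carrier_mat n n" and "invertible_mat G"
  shows "\<exists>S. positive_diagonal_mat n S \<and>
           (\<exists>U Q. unitary_mat n U \<and> complex_orthogonal_mat n Q \<and>
              G = U * map_mat complex_of_real S * Q) \<and>
           (\<forall>S' U' Q'. positive_diagonal_mat n S' \<and> unitary_mat n U' \<and>
              complex_orthogonal_mat n Q' \<and> G = U' * map_mat complex_of_real S' * Q' \<longrightarrow>
              same_diagonal_up_to_permutation n S S')"
proof -
  obtain R where R: "inverts_mat G R" "inverts_mat R G"
    using assms(2) by (auto simp: invertible_mat_def)
  have GR: "G * R = 1\<^sub>m n" and RG: "R * G = 1\<^sub>m (dim_row R)"
    using R assms(1) by (auto simp: inverts_mat_def)
  \<comment> \<open>Invertibility does not fix the shape of \<open>R\<close>; it follows by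
    comparing column counts in the two identity products.\<close>
  have "dim_col (G * R) = n" "dim_col (R * G) = dim_row R"
    unfolding GR RG by simp_all
  then have R': "R \<in> carrier_mat n n" using assms(1) by auto
  obtain S U Q where SUQ: "positive_diagonal_mat n S" "unitary_mat n U"
    "complex_orthogonal_mat n Q" "G = U * map_mat complex_of_real S * Q"
    using unitary_diagonal_orthogonal_decomposition[OF assms(1) R'] RG R' by auto
  then show ?thesis
    using same_diagonal_up_to_permutation_if_decompositions[OF SUQ] by blast
qed

end
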